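(* Let $m,n,k\in\mathbb{N}$ and $\Omega=[-1,1]^m$. Let $A_{m,n}=\{\alpha\in\mathbb{N}^m:\|\alpha\|_\infty\le n\}$, let $P_{m,n}=\{p_\alpha:\alpha\in A_{m,n}\}$ be the Legendre grid, let $W_{m,n}=\mathrm{diag}(w_\alpha)_{\alpha\in A_{m,n}}$ be the Gauss-Legendre cubature weight matrix, and for a function $f:\Omega\to\mathbb{R}$ let $F_{m,n}=(f(p_\alpha))_{\alpha\in A_{m,n}}\in\mathbb{R}^{|A_{m,n}|}$. Define the Sobolev cubature matrix $$W_{m,n,k}=\sum_{\beta\in\mathbb{N}^m,\ \|\beta\|_1\le k} D_\beta^T\,W_{m,n}\,D_\beta ,$$ where $D_\beta$ is the matrix of the differential operator $\partial_{x_1}^{\beta_1}\cdots\partial_{x_m}^{\beta_m}$ on $\Pi_{m,n}$ acting on vectors of values on the Legendre grid. Then the approximation $\|f\|_{H^k(\Omega)}^2\approx F_{m,n}^T\,W_{m,n,k}\,F_{m,n}$ is exact whenever $f\in\Pi_{m,n}$, i.e. for every $f\in\Pi_{m,n}$, $$\|f\|_{H^k(\Omega)}^2 = F_{m,n}^T\,W_{m,n,k}\,F_{m,n}.$$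
   Context: $\mathbb{N}$ includes $0$ (as entries of multi-indices). $\Pi_{m,n}=\mathrm{span}\{x^\alpha : \alpha\in\mathbb{N}^m,\ \|\alpha\|_\infty\le n\}$ is the space of real polynomials in $m$ variables of maximum degree at most $n$ in each variable; $|A_{m,n}|=(n+1)^m$, and vectors and matrices are indexed by $A_{m,n}$ (lexicographically ordered). Let $p_0,\dots,p_n\in(-1,1)$ be the $n+1$ Legendre nodes, i.e. the roots of the Legendre polynomial of degree $n+1$. For $\alpha\in A_{m,n}$ put $p_\alpha=(p_{\alpha_1},\dots,p_{\alpha_m})$. The Lagrange polynomials are $L_\alpha(x)=\prod_{i=1}^m\prod_{h\ne\alpha_i,\,0\le h\le n}\frac{x_i-p_h}{p_{\alpha_i}-p_h}\in\Pi_{m,n}$, so that $L_\alpha(p_\beta)=\delta_{\alpha,\beta}$. The Gauss-Legendre cubature weights are $w_\alpha=\|L_\alpha\|_{L^2(\Omega)}^2$. For $1\le i\le m$, $D_i\in\mathbb{R}^{|A_{m,n}|\times|A_{m,n}|}$ is the matrix representing $\partial_{x_i}$ on $\Pi_{m,n}$ in the Lagrange basis: its entry in row $\beta$, column $\alpha$ is $\partial_{x_i}L_\alpha(p_\beta)$, so $D_i(Q(p_\alpha))_\alpha=(\partial_{x_i}Q(p_\alpha))_\alpha$ for $Q\in\Pi_{m,n}$. For $\beta\in\mathbb{N}^m$, $D_\beta=\prod_{i=1}^m D_i^{\beta_i}$. The Sobolev norm is $\|f\|_{H^k(\Omega)}^2=\sum_{\beta\in\mathbb{N}^m,\ \|\beta\|_1\le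 k}\|\partial_{x_1}^{\beta_1}\cdots\partial_{x_m}^{\beta_m}f\|_{L^2(\Omega)}^2$. *)

theory Defs
  imports
    "HOL-Analysis.Analysis"
    "HOL-Computational_Algebra.Polynomial"
    "Jordan_Normal_Form.Matrix"
begin

text \<open>
  The dimension \<open>m\<close> is a natural number, possibly 0. A point of $\mathbb{R}^m$ is a function
  \<open>nat \<Rightarrow> real\<close> of which only the coordinates \<open>i < m\<close> matter, and a multi-index in $\mathbb{N}^m$
  is a list of length \<open>m\<close>; coordinates are counted from 0.
\<close>

definition multi_indices :: "nat \<Rightarrow> nat \<Rightarrow> nat list set" where
  "multi_indices m n = {\<alpha>. length \<alpha> = m \<and> (\<forall>i<m. \<alpha> ! i \<le> n)}"

text \<open>\<open>product_lists\<close> enumerates in lexicographic order, first entry most significant.\<close>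

definition multi_index_list :: "nat \<Rightarrow> nat \<Rightarrow> nat list list" where
  "multi_index_list m n = product_lists (replicate m [0..<Suc n])"

lemma set_multi_index_list: "set (multi_index_list m n) = multi_indices m n"
  by (auto simp: multi_index_list_def multi_indices_def product_lists_set list_all2_conv_all_nth
      less_Suc_eq_le simp del: upt_Suc)

lemma distinct_multi_index_list: "distinct (multi_index_list m n)"
  unfolding multi_index_list_def by (rule distinct_product_lists) simp

lemma length_multi_index_list: "length (multi_index_list m n) = Suc n ^ m"
  unfolding multi_index_list_def
  by (induction m) (simp_all add: length_concat comp_def sum_list_triv del: upt_Suc)

lemma sorted_multi_index_list:
  "sorted_wrt (\<lambda>\<alpha> \<beta>. (\<alpha>, \<beta>) \<in> lex less_than) (multi_index_list m n)"
proof -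
  have step: "sorted_wrt (\<lambda>\<alpha> \<beta>. (\<alpha>, \<beta>) \<in> lex less_than) (concat (map (\<lambda>x. map (Cons x) L) ns))"
    if "sorted_wrt (<) ns" "sorted_wrt (\<lambda>\<alpha> \<beta>. (\<alpha>, \<beta>) \<in> lex less_than) L"
      "\<forall>\<alpha>\<in>set L. length \<alpha> = l"
    for ns :: "nat list" and L :: "nat list list" and l
    using that by (induction ns) (auto simp: sorted_wrt_append sorted_wrt_map)
  show ?thesis
    unfolding multi_index_list_def
  proof (induction m)
    case 0
    show ?case by simp
  next
    case (Suc m)
    have "\<forall>\<alpha>\<in>set (product_lists (replicate m [0..<Suc n])). length \<alpha> = m"
      by (auto dest: in_set_product_lists_length simp del: upt_Suc)
    from step[OF sorted_wrt_upt Suc this] show ?case by (simp del: upt_Suc)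
  qed
qed

definition poly_space :: "nat \<Rightarrow> nat \<Rightarrow> ((nat \<Rightarrow> real) \<Rightarrow> real) set" where
  "poly_space m n = {f. \<exists>c. f = (\<lambda>x. \<Sum>\<alpha>\<in>multi_indices m n. c \<alpha> * (\<Prod>i<m. x i ^ (\<alpha> ! i)))}"

text \<open>Rodrigues' formula.\<close>

definition legendre :: "nat \<Rightarrow> real poly" where
  "legendre d = Polynomial.smult (1 / (2 ^ d * fact d)) ((pderiv ^^ d) ([:-1, 0, 1:] ^ d))"

text \<open>The roots of the Legendre polynomial of degree \<open>n + 1\<close>, in increasing order.\<close>

definition legendre_node :: "nat \<Rightarrow> nat \<Rightarrow> real" where
  "legendre_node n h = sorted_list_of_set {x. poly (legendre (Suc n)) x = 0} ! h"

text \<open>Points of the domain of integration are extensional functions, hence the restriction.\<close>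

definition grid_point :: "nat \<Rightarrow> nat \<Rightarrow> nat list \<Rightarrow> nat \<Rightarrow> real" where
  "grid_point m n \<alpha> = (\<lambda>i\<in>{..<m}. legendre_node n (\<alpha> ! i))"

definition lagrange :: "nat \<Rightarrow> nat \<Rightarrow> nat list \<Rightarrow> (nat \<Rightarrow> real) \<Rightarrow> real" where
  "lagrange m n \<alpha> x = (\<Prod>i<m. \<Prod>h\<in>{..n} - {\<alpha> ! i}.
     (x i - legendre_node n h) / (legendre_node n (\<alpha> ! i) - legendre_node n h))"

definition partial_deriv :: "nat \<Rightarrow> ((nat \<Rightarrow> real) \<Rightarrow> real) \<Rightarrow> (nat \<Rightarrow> real) \<Rightarrow> real" where
  "partial_deriv i f x = deriv (\<lambda>t. f (x(i := t))) (x i)"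

definition partial_deriv_multi ::
    "nat \<Rightarrow> nat list \<Rightarrow> ((nat \<Rightarrow> real) \<Rightarrow> real) \<Rightarrow> (nat \<Rightarrow> real) \<Rightarrow> real" where
  "partial_deriv_multi m \<beta> f = foldr (\<lambda>i. partial_deriv i ^^ (\<beta> ! i)) [0..<m] f"

definition cube :: "nat \<Rightarrow> (nat \<Rightarrow> real) set" where
  "cube m = ({..<m} \<rightarrow>\<^sub>E {-1..1})"

definition L2_norm_cube :: "nat \<Rightarrow> ((nat \<Rightarrow> real) \<Rightarrow> real) \<Rightarrow> real" where
  "L2_norm_cube m f = sqrt (LINT x:cube m|(\<Pi>\<^sub>M i\<in>{..<m}. lborel). (f x)\<^sup>2)"

definition multi_indices_sum_le :: "nat \<Rightarrow> nat \<Rightarrow> nat list set" where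
  "multi_indices_sum_le m k = {\<beta>. length \<beta> = m \<and> sum_list \<beta> \<le> k}"

text \<open>Derivatives are classical ones, so this is the Sobolev norm for smooth \<open>f\<close> only.\<close>

definition sobolev_norm :: "nat \<Rightarrow> nat \<Rightarrow> ((nat \<Rightarrow> real) \<Rightarrow> real) \<Rightarrow> real" where
  "sobolev_norm m k f =
     sqrt (\<Sum>\<beta>\<in>multi_indices_sum_le m k. (L2_norm_cube m (partial_deriv_multi m \<beta> f))\<^sup>2)"

definition cubature_weight :: "nat \<Rightarrow> nat \<Rightarrow> nat list \<Rightarrow> real" where
  "cubature_weight m n \<alpha> = (L2_norm_cube m (lagrange m n \<alpha>))\<^sup>2"

definition weight_mat :: "nat \<Rightarrow> nat \<Rightarrow> real mat" where
  "weight_mat m n = mat_diag (Suc n ^ m) (\<lambda>r. cubature_weight m n (multi_index_list m n ! r))"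

definition diff_mat :: "nat \<Rightarrow> nat \<Rightarrow> nat \<Rightarrow> real mat" where
  "diff_mat m n i = Matrix.mat (Suc n ^ m) (Suc n ^ m) (\<lambda>(r, c).
     partial_deriv i (lagrange m n (multi_index_list m n ! c))
       (grid_point m n (multi_index_list m n ! r)))"

definition diff_mat_multi :: "nat \<Rightarrow> nat \<Rightarrow> nat list \<Rightarrow> real mat" where
  "diff_mat_multi m n \<beta> =
     foldr (\<lambda>i M. (diff_mat m n i ^\<^sub>m (\<beta> ! i)) * M) [0..<m] (1\<^sub>m (Suc n ^ m))"

text \<open>The matrix sum is taken entrywise, as \<open>mat\<close> is not an instance of \<open>comm_monoid_add\<close>.\<close>

definition sobolev_cubature_mat :: "nat \<Rightarrow> nat \<Rightarrow> nat \<Rightarrow> real mat" where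
  "sobolev_cubature_mat m n k = Matrix.mat (Suc n ^ m) (Suc n ^ m) (\<lambda>(r, c).
     \<Sum>\<beta>\<in>multi_indices_sum_le m k.
       (transpose_mat (diff_mat_multi m n \<beta>) * weight_mat m n * diff_mat_multi m n \<beta>) $$ (r, c))"

definition grid_values :: "nat \<Rightarrow> nat \<Rightarrow> ((nat \<Rightarrow> real) \<Rightarrow> real) \<Rightarrow> real Matrix.vec" where
  "grid_values m n f =
     Matrix.vec (Suc n ^ m) (\<lambda>r. f (grid_point m n (multi_index_list m n ! r)))"

end

theory Submission
  imports Defs
begin

text \<open>
  In one variable, the product of two distinct Lagrange polynomials has degree at most \<open>2n\<close> and
  vanishes at all nodes, so it is the Legendre polynomial of degree \<open>n + 1\<close> times a polynomial of
  smaller degree, and its integral over \<open>[-1, 1]\<close> is 0 by orthogonality. Since integrals of tensor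
  products factor, the Lagrange basis is orthogonal in \<open>L\<^sup>2\<close> of the cube with squared norms the
  cubature weights; hence the squared norm of any interpolated function is the weighted sum of its
  squared grid values. As partial derivatives preserve the polynomial space, this applies to each
  derivative, whose grid values are obtained by applying the differentiation matrices.
\<close>

section \<open>Legendre nodes\<close>

text \<open>Rolle's theorem in the gaps between consecutive points of \<open>S\<close>, which are
  added in increasing order. Keeping \<open>T\<close> strictly between \<open>Min S\<close> and
  \<open>Max S\<close> ensures that the critical point in each further gap is a new one.\<close>

lemma poly_roots_pderiv:
  fixes p :: "real poly"
  assumes "finite S" "S \<noteq> {}" "\<And>x. x \<in> S \<Longrightarrow> poly p x = 0"
  shows "\<exists>T. finite T \<and> Suc (card T) = card S \<and> T \<subseteq> {Min S<..<Max S} \<and> (\<forall>x\<in>T. poly (pderiv p) x = 0)"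
  using assms
proof (induction S rule: finite_linorder_max_induct)
  case empty
  then show ?case by simp
next
  case (insert b S)
  show ?case
  proof (cases "S = {}")
    case True
    then show ?thesis by (intro exI[of _ "{}"]) auto
  next
    case False
    then obtain T where T: "finite T" "Suc (card T) = card S" "T \<subseteq> {Min S<..<Max S}"
        "\<forall>x\<in>T. poly (pderiv p) x = 0"
      using insert by auto
    have M: "Max S \<in> S" "Max S < b" "Min S \<le> Max S" "Min S < b"
      using False insert by (auto intro: Min.coboundedI)
    then obtain z where z: "Max S < z" "z < b" "poly p b - poly p (Max S) = (b - Max S) * poly (pderiv p) z"
      using poly_MVT by blast
    have "poly (pderiv p) z = 0"
      using z M insert.prems by auto
    moreover have "Min (insert b S) = Min S" "Max (insert b S) = b"
      using False insert.hyps M by (simp_all add: min.absorb2 max.absorb1)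
    moreover have "b \<notin> S" "z \<notin> T" using insert.hyps z T by auto
    moreover have "insert z T \<subseteq> {Min S<..<b}"
    proof -
      have "Min S < z" using M z by linarith
      moreover have "x < b" if "x \<in> T" for x
        using T(3) M(2) that by fastforce
      ultimately show ?thesis using T(3) z by auto
    qed
    ultimately show ?thesis
      using T insert.hyps by (intro exI[of _ "insert z T"]) auto
  qed
qed

lemma power_dvd_pderiv:
  assumes "q ^ Suc k dvd (p :: real poly)"
  shows "q ^ k dvd pderiv p"
proof -
  obtain r where "p = q ^ Suc k * r" using assms by (elim dvdE)
  then have "pderiv p = q ^ k * (q * pderiv r + r * Polynomial.smult (of_nat (Suc k)) (pderiv q))"
    by (simp only: pderiv_mult pderiv_power_Suc) (simp add: algebra_simps)
  then show ?thesis by simp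
qed

lemma power_dvd_pderiv_funpow:
  assumes "j \<le> d"
  shows "q ^ (d - j) dvd (pderiv ^^ j) (q ^ d :: real poly)"
  using assms
proof (induction j)
  case (Suc j)
  then have "q ^ Suc (d - Suc j) dvd (pderiv ^^ j) (q ^ d)"
    by (simp add: Suc_diff_Suc del: power_Suc)
  then show ?case using power_dvd_pderiv by simp
qed simp

text \<open>For \<open>j < d\<close> a factor x^2 - 1 survives the \<open>j\<close>
  differentiations. This provides the extra roots for Rolle's theorem and kills the boundary terms
  in integration by parts.\<close>

lemma poly_pderiv_funpow_endpoints:
  assumes "j < d" "x \<in> {-1, 1}"
  shows "poly ((pderiv ^^ j) ([:-1, 0, 1:] ^ d)) x = (0 :: real)"
proof -
  have "[:-1, 0, 1:] dvd ([:-1, 0, 1:] ^ (d - j) :: real poly)"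
    using assms by (intro dvd_power) auto
  then have "[:-1, 0, 1:] dvd (pderiv ^^ j) ([:-1, 0, 1:] ^ d :: real poly)"
    using power_dvd_pderiv_funpow[of j d "[:-1, 0, 1:]"] assms by (meson dvd_trans less_imp_le)
  then show ?thesis using assms by (auto elim!: dvdE)
qed

lemma degree_legendre: "degree (legendre d) = d"
proof -
  have "degree ((pderiv ^^ j) p) = degree p - j" for j and p :: "real poly"
    by (induction j) (simp_all add: degree_pderiv)
  then show ?thesis by (simp add: legendre_def degree_power_eq)
qed

definition legendre_nodes :: "nat \<Rightarrow> real set" where
  "legendre_nodes n = {x. poly (legendre (Suc n)) x = 0}"

lemma legendre_nonzero: "legendre (Suc n) \<noteq> 0"
  using degree_legendre[of "Suc n"] by auto

lemma finite_legendre_nodes: "finite (legendre_nodes n)"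
  unfolding legendre_nodes_def using poly_roots_finite legendre_nonzero by blast

text \<open>Induction by Rolle's theorem: the \<open>j\<close> interior roots and the endpoints -1
  and 1, which are still roots while \<open>j < d\<close>, are \<open>j + 2\<close> points and yield
  \<open>j + 1\<close> interior roots of the next derivative.\<close>

lemma roots_pderiv_funpow:
  assumes "j \<le> d"
  shows "\<exists>T. finite T \<and> card T = j \<and> T \<subseteq> {-1<..<1} \<and>
    (\<forall>x\<in>T. poly ((pderiv ^^ j) ([:-1, 0, 1:] ^ d)) x = (0::real))"
  using assms
proof (induction j)
  case 0
  then show ?case by (intro exI[of _ "{}"]) auto
next
  case (Suc j)
  then obtain T where T: "finite T" "card T = j" "T \<subseteq> {-1<..<1}"
      "\<forall>x\<in>T. poly ((pderiv ^^ j) ([:-1, 0, 1:] ^ d)) x = (0::real)" by auto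
  let ?S = "insert (-1) (insert 1 T)"
  have "Min ?S = -1" "Max ?S = 1"
    by (rule Min_eqI Max_eqI; use T in auto)+
  moreover have "card ?S = Suc (Suc j)" using T by (subst card_insert_disjoint) (auto simp: card_insert_if)
  moreover have "poly ((pderiv ^^ j) ([:-1, 0, 1:] ^ d)) x = (0::real)" if "x \<in> ?S" for x
    using that T Suc.prems poly_pderiv_funpow_endpoints[of j d x] by auto
  ultimately show ?case
    using poly_roots_pderiv[of ?S "(pderiv ^^ j) ([:-1, 0, 1:] ^ d)"] T by auto
qed

text \<open>The degree bounds the number of roots from above; Rodrigues' formula and
  \<open>roots_pderiv_funpow\<close> at \<open>j = d = n + 1\<close> bound it from below. Hence the
  sorted list behind \<open>legendre_node\<close> has exactly the positions 0 to
  \<open>n\<close>.\<close>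

lemma card_legendre_nodes: "card (legendre_nodes n) = Suc n"
proof (rule antisym)
  show "card (legendre_nodes n) \<le> Suc n"
    using card_poly_roots_bound[OF legendre_nonzero[of n]]
    by (simp add: legendre_nodes_def degree_legendre)
  obtain T where T: "finite T" "card T = Suc n"
      "\<forall>x\<in>T. poly ((pderiv ^^ Suc n) ([:-1, 0, 1:] ^ Suc n)) x = (0::real)"
    using roots_pderiv_funpow[of "Suc n" "Suc n"] by auto
  then have "T \<subseteq> legendre_nodes n"
    by (auto simp: legendre_nodes_def legendre_def)
  then show "Suc n \<le> card (legendre_nodes n)"
    using T card_mono[OF finite_legendre_nodes] by metis
qed

lemma bij_betw_legendre_node: "bij_betw (legendre_node n) {..n} (legendre_nodes n)"
proof -
  have "bij_betw (\<lambda>h. sorted_list_of_set (legendre_nodes n) ! h) {..<Suc n} (legendre_nodes n)"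
    by (intro bij_betw_nth) (simp_all add: finite_legendre_nodes card_legendre_nodes)
  then show ?thesis
    by (simp add: legendre_node_def[abs_def] legendre_nodes_def lessThan_Suc_atMost)
qed

lemma legendre_node_eq_iff:
  "a \<le> n \<Longrightarrow> b \<le> n \<Longrightarrow> legendre_node n a = legendre_node n b \<longleftrightarrow> a = b"
  using bij_betw_legendre_node[of n] by (auto simp: bij_betw_def inj_on_eq_iff)

lemma poly_eqI_legendre_nodes:
  assumes "degree p \<le> n" "degree q \<le> n"
    and "\<And>a. a \<le> n \<Longrightarrow> poly p (legendre_node n a) = poly q (legendre_node n a)"
  shows "p = q"
proof (rule poly_eqI_degree[of "legendre_nodes n"])
  show "poly p x = poly q x" if "x \<in> legendre_nodes n" for x
  proof -
    have "x \<in> legendre_node n ` {..n}"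
      using that bij_betw_imp_surj_on[OF bij_betw_legendre_node[of n]] by simp
    then show ?thesis using assms(3) by auto
  qed
qed (use assms(1,2) in \<open>simp_all add: card_legendre_nodes\<close>)

section \<open>One-dimensional quadrature\<close>

text \<open>The indicator is a factor of the integrand, so that integrands over the cube split into
  one such factor per coordinate.\<close>

definition poly_integral :: "real poly \<Rightarrow> real" where
  "poly_integral p = (\<integral>x. indicator {-1..1} x * poly p x \<partial>lborel)"

lemma integrable_poly_indicator: "integrable lborel (\<lambda>x::real. indicator {-1..1} x * poly p x)"
  using borel_integrable_compact[of "{-1..1::real}" "poly p"]
  by (simp add: continuous_on_poly[OF continuous_on_id])

lemma poly_integral_add: "poly_integral (p + q) = poly_integral p + poly_integral q"
  by (simp add: poly_integral_def distrib_left integrable_poly_indicator)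

lemma poly_integral_zero: "poly_integral 0 = 0"
  by (simp add: poly_integral_def)

lemma poly_integral_smult: "poly_integral (Polynomial.smult c p) = c * poly_integral p"
  by (simp add: poly_integral_def mult.left_commute)

lemma poly_integral_pderiv: "poly_integral (pderiv p) = poly p 1 - poly p (-1)"
  using integral_FTC_Icc_real[of "-1" 1 "poly p" "poly (pderiv p)"]
  by (simp add: poly_integral_def mult.commute)

lemma poly_integral_by_parts:
  assumes "poly u 1 = 0" "poly u (-1) = 0"
  shows "poly_integral (pderiv u * v) = - poly_integral (u * pderiv v)"
  using poly_integral_pderiv[of "u * v"] assms
  by (simp add: pderiv_mult poly_integral_add mult.commute)

text \<open>Repeated integration by parts moves the derivatives onto \<open>v\<close> until they
  annihilate it. The order \<open>j\<close> is kept apart from the exponent \<open>d\<close>, as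
  only \<open>j\<close> decreases in the induction.\<close>

lemma poly_integral_pderiv_funpow_mult:
  assumes "j \<le> d" "degree v < j"
  shows "poly_integral ((pderiv ^^ j) ([:-1, 0, 1:] ^ d) * v) = 0"
  using assms
proof (induction j arbitrary: v)
  case (Suc j)
  have "poly_integral ((pderiv ^^ Suc j) ([:-1, 0, 1:] ^ d) * v) =
      - poly_integral ((pderiv ^^ j) ([:-1, 0, 1:] ^ d) * pderiv v)"
    unfolding funpow.simps o_def
    using Suc.prems by (intro poly_integral_by_parts poly_pderiv_funpow_endpoints) auto
  also have "\<dots> = 0"
  \<comment> \<open>On degrees, \<open>pderiv\<close> acts as truncated subtraction, so a constant
    \<open>v\<close> would not get a smaller degree; its derivative is 0 instead.\<close>
  proof (cases "degree v = 0")
    case True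
    then have "pderiv v = 0" by (simp add: pderiv_eq_0_iff)
    then show ?thesis by (simp add: poly_integral_zero)
  next
    case False
    then show ?thesis using Suc by (simp add: degree_pderiv)
  qed
  finally show ?case .
qed simp

lemma poly_integral_legendre_mult:
  assumes "degree v < d"
  shows "poly_integral (legendre d * v) = 0"
  using poly_integral_pderiv_funpow_mult[of d d v] assms
  by (simp add: legendre_def poly_integral_smult)

text \<open>Division by the Legendre polynomial leaves no remainder, by counting roots, and the quotient
  has degree at most \<open>n\<close>, so orthogonality applies.\<close>

lemma poly_integral_vanishing_at_nodes:
  assumes "degree p \<le> 2 * n + 1" "\<And>a. a \<le> n \<Longrightarrow> poly p (legendre_node n a) = 0"
  shows "poly_integral p = 0"
proof -
  let ?l = "legendre (Suc n)"
  have node: "poly ?l (legendre_node n a) = 0" if "a \<le> n" for a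
    using that bij_betw_legendre_node[of n] by (auto simp: bij_betw_def legendre_nodes_def)
  have mod: "p mod ?l = 0"
  proof (rule poly_eqI_legendre_nodes)
    show "degree (p mod ?l) \<le> n"
      using degree_mod_less[OF legendre_nonzero[of n], of p] by (auto simp: degree_legendre)
    show "poly (p mod ?l) (legendre_node n a) = poly 0 (legendre_node n a)" if "a \<le> n" for a
    proof -
      have "poly p (legendre_node n a) = poly (?l * (p div ?l) + p mod ?l) (legendre_node n a)"
        by (simp only: mult_div_mod_eq)
      then show ?thesis
        unfolding poly_add poly_mult by (simp add: assms(2)[OF that] node[OF that])
    qed
  qed simp
  have p: "?l * (p div ?l) = p"
    using mult_div_mod_eq[of ?l p] unfolding mod by (simp only: add_0_right)
  have "degree (p div ?l) < Suc n"
  proof (cases "p div ?l = 0")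
    case False
    have "degree p = degree (?l * (p div ?l))" by (simp only: p)
    also have "\<dots> = Suc n + degree (p div ?l)"
      using False legendre_nonzero by (simp add: degree_mult_eq degree_legendre)
    finally show ?thesis using assms(1) by simp
  qed simp
  then show ?thesis
    using poly_integral_legendre_mult[of "p div ?l" "Suc n"] unfolding p by blast
qed

section \<open>Lagrange interpolation in one variable\<close>

definition lagrange_poly :: "nat \<Rightarrow> nat \<Rightarrow> real poly" where
  "lagrange_poly n a = (\<Prod>h\<in>{..n} - {a}.
     Polynomial.smult (1 / (legendre_node n a - legendre_node n h)) [:- legendre_node n h, 1:])"

lemma degree_lagrange_poly:
  assumes "a \<le> n"
  shows "degree (lagrange_poly n a) \<le> n"
proof -
  \<comment> \<open>Each factor has degree at most 1, and \<open>a \<le> n\<close> leaves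
    \<open>n\<close> of the \<open>n + 1\<close> indices.\<close>
  have "degree (lagrange_poly n a) \<le> (\<Sum>h\<in>{..n} - {a}. 1)"
    unfolding lagrange_poly_def
    by (rule order_trans[OF degree_prod_sum_le sum_mono]) (auto simp: degree_smult_eq)
  then show ?thesis using assms by simp
qed

lemma poly_lagrange_poly:
  "poly (lagrange_poly n a) x =
    (\<Prod>h\<in>{..n} - {a}. (x - legendre_node n h) / (legendre_node n a - legendre_node n h))"
  by (simp add: lagrange_poly_def poly_prod diff_divide_distrib)

lemma poly_lagrange_poly_node:
  assumes "a \<le> n" "b \<le> n"
  shows "poly (lagrange_poly n a) (legendre_node n b) = (if a = b then 1 else 0)"
  using assms by (auto simp: poly_lagrange_poly legendre_node_eq_iff intro!: prod.neutral)

text \<open>Both sides have degree at most \<open>n\<close> and agree at \<open>n + 1\<close> nodes,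
  so they coincide as polynomials and hence at every \<open>x\<close>.\<close>

lemma lagrange_interpolation:
  assumes "degree q \<le> n"
  shows "poly q x = (\<Sum>a\<le>n. poly q (legendre_node n a) * poly (lagrange_poly n a) x)"
proof -
  have "q = (\<Sum>a\<le>n. Polynomial.smult (poly q (legendre_node n a)) (lagrange_poly n a))"
  proof (rule poly_eqI_legendre_nodes[OF assms])
    show "degree (\<Sum>a\<le>n. Polynomial.smult (poly q (legendre_node n a)) (lagrange_poly n a)) \<le> n"
      by (intro degree_sum_le) (auto simp: degree_lagrange_poly)
  qed (simp add: poly_sum poly_lagrange_poly_node if_distrib cong: if_cong)
  then have "poly q x = poly (\<Sum>a\<le>n. Polynomial.smult (poly q (legendre_node n a)) (lagrange_poly n a)) x"
    by (rule arg_cong)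
  then show ?thesis unfolding poly_sum poly_smult .
qed

lemma poly_integral_lagrange_mult:
  assumes "a \<le> n" "b \<le> n" "a \<noteq> b"
  shows "poly_integral (lagrange_poly n a * lagrange_poly n b) = 0"
proof (rule poly_integral_vanishing_at_nodes)
  show "degree (lagrange_poly n a * lagrange_poly n b) \<le> 2 * n + 1"
    using degree_mult_le[of "lagrange_poly n a" "lagrange_poly n b"]
      degree_lagrange_poly[OF assms(1)] degree_lagrange_poly[OF assms(2)] by linarith
qed (use assms in \<open>auto simp: poly_lagrange_poly_node\<close>)

section \<open>Tensor products of polynomials\<close>

text \<open>Monomials and Lagrange polynomials both have this form, and it is stable under partial
  derivatives and products.\<close>

definition tensor :: "nat \<Rightarrow> (nat \<Rightarrow> real poly) \<Rightarrow> (nat \<Rightarrow> real) \<Rightarrow> real" where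
  "tensor m G x = (\<Prod>i<m. poly (G i) (x i))"

lemma lagrange_eq_tensor: "lagrange m n \<alpha> = tensor m (\<lambda>i. lagrange_poly n (\<alpha> ! i))"
  by (simp add: lagrange_def tensor_def poly_lagrange_poly fun_eq_iff)

lemma DERIV_tensor:
  assumes "i < m"
  shows "((\<lambda>t. tensor m G (x(i := t))) has_field_derivative
    tensor m (G(i := pderiv (G i))) x) (at (x i))"
proof -
  \<comment> \<open>Stated for all \<open>H\<close> and \<open>y\<close>, to serve both for
    \<open>G\<close> at the modified point and for the modified \<open>G\<close> at
    \<open>x\<close>.\<close>
  have split: "tensor m H y = poly (H i) (y i) * (\<Prod>j\<in>{..<m} - {i}. poly (H j) (y j))" for H y
    unfolding tensor_def using assms by (subst prod.remove[of _ i]) auto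
  have "(\<lambda>t. tensor m G (x(i := t))) =
      (\<lambda>t. poly (G i) t * (\<Prod>j\<in>{..<m} - {i}. poly (G j) (x j)))"
    by (auto simp: split fun_eq_iff intro!: prod.cong)
  moreover have "tensor m (G(i := pderiv (G i))) x =
      poly (pderiv (G i)) (x i) * (\<Prod>j\<in>{..<m} - {i}. poly (G j) (x j))"
    by (auto simp: split intro!: prod.cong)
  ultimately show ?thesis by (auto intro!: DERIV_cmult_right poly_DERIV)
qed

text \<open>Linearity of \<open>deriv\<close> requires differentiable summands;
  \<open>DERIV_tensor\<close> supplies this.\<close>

lemma partial_deriv_sum_tensor:
  assumes "i < m"
  shows "partial_deriv i (\<lambda>x. \<Sum>\<alpha>\<in>A. c \<alpha> * tensor m (G \<alpha>) x) =
    (\<lambda>x. \<Sum>\<alpha>\<in>A. c \<alpha> * tensor m ((G \<alpha>)(i := pderiv (G \<alpha> i))) x)"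
  unfolding partial_deriv_def
  by (intro ext DERIV_imp_deriv DERIV_sum DERIV_cmult DERIV_tensor assms)

lemma partial_deriv_tensor:
  "i < m \<Longrightarrow> partial_deriv i (tensor m G) = tensor m (G(i := pderiv (G i)))"
  unfolding partial_deriv_def by (intro ext DERIV_imp_deriv DERIV_tensor)

section \<open>Interpolation on the grid\<close>

lemma finite_multi_indices: "finite (multi_indices m n)"
  using set_multi_index_list[of m n] by (metis List.finite_set)

text \<open>Distributivity: a multi-index records which term is picked from each factor. Lists of
  length \<open>m\<close> take the place of extensional functions on \<open>{..<m}\<close>.\<close>

lemma prod_sum_multi_indices:
  fixes g :: "nat \<Rightarrow> nat \<Rightarrow> real"
  shows "(\<Prod>i<m. \<Sum>a\<le>n. g i a) = (\<Sum>\<alpha>\<in>multi_indices m n. \<Prod>i<m. g i (\<alpha> ! i))"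
proof -
  have "(\<Prod>i<m. \<Sum>a\<le>n. g i a) = (\<Sum>h\<in>{..<m} \<rightarrow>\<^sub>E {..n}. \<Prod>i<m. g i (h i))"
    by (intro prod_sum_PiE) auto
  also have "\<dots> = (\<Sum>\<alpha>\<in>multi_indices m n. \<Prod>i<m. g i (\<alpha> ! i))"
    by (rule sum.reindex_bij_witness[of _ "\<lambda>\<alpha>. \<lambda>i\<in>{..<m}. \<alpha> ! i" "\<lambda>h. map h [0..<m]"])
      (auto simp: multi_indices_def PiE_def extensional_def fun_eq_iff intro!: nth_equalityI)
  finally show ?thesis .
qed

text \<open>Working substitute for \<open>poly_space\<close>: the coefficients in the Lagrange basis
  are the grid values, and the equation holds at all points, so it may be differentiated.\<close>

definition interpolated :: "nat \<Rightarrow> nat \<Rightarrow> ((nat \<Rightarrow> real) \<Rightarrow> real) \<Rightarrow> bool" where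
  "interpolated m n f \<longleftrightarrow>
     f = (\<lambda>x. \<Sum>\<alpha>\<in>multi_indices m n. f (grid_point m n \<alpha>) * lagrange m n \<alpha> x)"

lemma interpolatedD:
  assumes "interpolated m n f"
  shows "f x = (\<Sum>\<alpha>\<in>multi_indices m n. f (grid_point m n \<alpha>) * lagrange m n \<alpha> x)"
  by (rule fun_cong[OF assms[unfolded interpolated_def]])

text \<open>Interpolate each factor in its own variable and expand the product of sums.\<close>

lemma interpolated_tensor:
  assumes "\<And>i. i < m \<Longrightarrow> degree (G i) \<le> n"
  shows "interpolated m n (tensor m G)"
  unfolding interpolated_def
proof
  fix x
  have "tensor m G x =
      (\<Prod>i<m. \<Sum>a\<le>n. poly (G i) (legendre_node n a) * poly (lagrange_poly n a) (x i))"
    unfolding tensor_def using assms by (intro prod.cong lagrange_interpolation) auto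
  also have "\<dots> = (\<Sum>\<alpha>\<in>multi_indices m n. tensor m G (grid_point m n \<alpha>) * lagrange m n \<alpha> x)"
    by (simp add: prod_sum_multi_indices prod.distrib lagrange_eq_tensor tensor_def grid_point_def)
  finally show "tensor m G x =
      (\<Sum>\<alpha>\<in>multi_indices m n. tensor m G (grid_point m n \<alpha>) * lagrange m n \<alpha> x)" .
qed

lemma interpolated_sum:
  assumes "\<And>b. b \<in> B \<Longrightarrow> interpolated m n (g b)"
  shows "interpolated m n (\<lambda>x. \<Sum>b\<in>B. c b * g b x)"
  unfolding interpolated_def
proof
  fix x
  have "(\<Sum>b\<in>B. c b * g b x) = (\<Sum>b\<in>B. c b *
      (\<Sum>\<alpha>\<in>multi_indices m n. g b (grid_point m n \<alpha>) * lagrange m n \<alpha> x))"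
    by (intro sum.cong refl arg_cong2[of _ _ _ _ "(*)"] interpolatedD assms)
  also have "\<dots> = (\<Sum>\<alpha>\<in>multi_indices m n.
      (\<Sum>b\<in>B. c b * g b (grid_point m n \<alpha>)) * lagrange m n \<alpha> x)"
    by (simp only: sum_distrib_left sum_distrib_right mult.assoc) (rule sum.swap)
  finally show "(\<Sum>b\<in>B. c b * g b x) = (\<Sum>\<alpha>\<in>multi_indices m n.
      (\<Sum>b\<in>B. c b * g b (grid_point m n \<alpha>)) * lagrange m n \<alpha> x)" .
qed

lemma interpolated_poly_space:
  assumes "f \<in> poly_space m n"
  shows "interpolated m n f"
proof -
  obtain c where f: "f = (\<lambda>x. \<Sum>\<alpha>\<in>multi_indices m n. c \<alpha> * (\<Prod>i<m. x i ^ (\<alpha> ! i)))"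
    using assms unfolding poly_space_def by blast
  have "interpolated m n (\<lambda>x. \<Prod>i<m. x i ^ (\<alpha> ! i))" if "\<alpha> \<in> multi_indices m n" for \<alpha>
  proof -
    have "interpolated m n (tensor m (\<lambda>i. Polynomial.monom 1 (\<alpha> ! i)))"
      using that by (intro interpolated_tensor) (simp add: multi_indices_def degree_monom_eq)
    then show ?thesis by (simp add: tensor_def[abs_def] poly_monom)
  qed
  then show ?thesis unfolding f by (intro interpolated_sum)
qed

text \<open>The expansion is differentiated term by term, its coefficients being constants. At grid
  points this is the action of \<open>diff_mat\<close>.\<close>

lemma partial_deriv_interpolated:
  assumes "interpolated m n f" "i < m"
  shows "partial_deriv i f = (\<lambda>x. \<Sum>\<alpha>\<in>multi_indices m n.
    f (grid_point m n \<alpha>) * partial_deriv i (lagrange m n \<alpha>) x)"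
proof -
  have "f = (\<lambda>x. \<Sum>\<alpha>\<in>multi_indices m n. f (grid_point m n \<alpha>) *
      tensor m (\<lambda>i. lagrange_poly n (\<alpha> ! i)) x)"
    using assms(1) unfolding interpolated_def lagrange_eq_tensor .
  then have "partial_deriv i f = partial_deriv i (\<lambda>x. \<Sum>\<alpha>\<in>multi_indices m n.
      f (grid_point m n \<alpha>) * tensor m (\<lambda>i. lagrange_poly n (\<alpha> ! i)) x)"
    by (rule arg_cong)
  then show ?thesis
    unfolding partial_deriv_sum_tensor[OF assms(2)] lagrange_eq_tensor
      partial_deriv_tensor[OF assms(2)] .
qed

text \<open>Differentiating a Lagrange polynomial replaces one univariate factor by its derivative,
  and no degree grows.\<close>

lemma interpolated_partial_deriv:
  assumes "interpolated m n f" "i < m"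
  shows "interpolated m n (partial_deriv i f)"
  unfolding partial_deriv_interpolated[OF assms]
proof (rule interpolated_sum)
  fix \<alpha> assume \<alpha>: "\<alpha> \<in> multi_indices m n"
  show "interpolated m n (partial_deriv i (lagrange m n \<alpha>))"
    unfolding lagrange_eq_tensor partial_deriv_tensor[OF assms(2)]
  proof (rule interpolated_tensor)
    fix j assume "j < m"
    then have "degree (lagrange_poly n (\<alpha> ! j)) \<le> n"
      using \<alpha> by (intro degree_lagrange_poly) (auto simp: multi_indices_def)
    then show "degree (((\<lambda>i. lagrange_poly n (\<alpha> ! i))(i := pderiv (lagrange_poly n (\<alpha> ! i)))) j) \<le> n"
      by (auto simp: degree_pderiv)
  qed
qed

lemma interpolated_partial_deriv_funpow:
  "interpolated m n f \<Longrightarrow> i < m \<Longrightarrow> interpolated m n ((partial_deriv i ^^ k) f)"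
  by (induction k) (auto intro: interpolated_partial_deriv)

text \<open>The coordinate list is arbitrary because the tail of \<open>[0..<m]\<close> no longer
  starts at 0.\<close>

lemma interpolated_partial_deriv_foldr:
  "interpolated m n f \<Longrightarrow> set is \<subseteq> {..<m} \<Longrightarrow>
    interpolated m n (foldr (\<lambda>i. partial_deriv i ^^ (\<beta> ! i)) is f)"
proof (induction "is")
  case (Cons i js)
  then have "interpolated m n (foldr (\<lambda>i. partial_deriv i ^^ (\<beta> ! i)) js f)" "i < m" by simp_all
  then show ?case
    unfolding foldr.simps o_apply by (rule interpolated_partial_deriv_funpow)
qed simp

section \<open>Cubature\<close>

text \<open>Membership in the space of the product measure makes \<open>x\<close> extensional, which
  \<open>cube\<close> demands besides the bounds on the coordinates.\<close>

lemma cube_integrand_tensor: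
  assumes "x \<in> space (\<Pi>\<^sub>M i\<in>{..<m}. lborel)"
  shows "indicator (cube m) x *\<^sub>R tensor m G x = (\<Prod>i<m. indicator {-1..1} (x i) * poly (G i) (x i))"
proof -
  have "indicator (cube m) x = (\<Prod>i<m. indicator {-1..1} (x i) :: real)"
  proof (cases "\<forall>i<m. x i \<in> {-1..1}")
    case True
    then have "x \<in> cube m" using assms unfolding cube_def space_PiM PiE_iff by blast
    with True show ?thesis by simp
  next
    case False
    then obtain i where "i < m" "x i \<notin> {-1..1}" by blast
    moreover from this have "x \<notin> cube m" unfolding cube_def PiE_iff by blast
    moreover have "(\<Prod>i<m. indicator {-1..1} (x i) :: real) = 0"
      using calculation(1,2) by (intro prod_zero) (auto intro!: bexI[of _ i])
    ultimately show ?thesis by simp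
  qed
  then show ?thesis by (simp add: tensor_def prod.distrib)
qed

lemma product_sigma_finite_lborel: "product_sigma_finite (\<lambda>_::nat. lborel :: real measure)"
  by standard

lemma set_integrable_tensor: "set_integrable (\<Pi>\<^sub>M i\<in>{..<m}. lborel) (cube m) (tensor m G)"
proof -
  have "integrable (\<Pi>\<^sub>M i\<in>{..<m}. lborel)
      (\<lambda>x. \<Prod>i<m. indicator {-1..1} (x i) * poly (G i) (x i))"
    by (intro product_sigma_finite.product_integrable_prod[OF product_sigma_finite_lborel]
        integrable_poly_indicator) simp
  then show ?thesis
    unfolding set_integrable_def
    by (subst Bochner_Integration.integrable_cong[OF refl cube_integrand_tensor])
qed

lemma set_integral_tensor:
  "(LINT x:cube m|(\<Pi>\<^sub>M i\<in>{..<m}. lborel). tensor m G x) = (\<Prod>i<m. poly_integral (G i))"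
  unfolding set_lebesgue_integral_def poly_integral_def
proof -
  have "(\<integral>x. indicator (cube m) x *\<^sub>R tensor m G x \<partial>(\<Pi>\<^sub>M i\<in>{..<m}. lborel)) =
      (\<integral>x. (\<Prod>i<m. indicator {-1..1} (x i) * poly (G i) (x i)) \<partial>(\<Pi>\<^sub>M i\<in>{..<m}. lborel))"
    by (rule Bochner_Integration.integral_cong[OF refl cube_integrand_tensor])
  also have "\<dots> = (\<Prod>i<m. \<integral>t. indicator {-1..1} t * poly (G i) t \<partial>lborel)"
    by (rule product_sigma_finite.product_integral_prod[OF product_sigma_finite_lborel
          finite_lessThan integrable_poly_indicator])
  finally show "(\<integral>x. indicator (cube m) x *\<^sub>R tensor m G x \<partial>(\<Pi>\<^sub>M i\<in>{..<m}. lborel)) =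
      (\<Prod>i<m. \<integral>t. indicator {-1..1} t * poly (G i) t \<partial>lborel)" .
qed

lemma tensor_mult: "tensor m G x * tensor m H x = tensor m (\<lambda>i. G i * H i) x"
  by (simp add: tensor_def prod.distrib)

lemma L2_norm_cube_sq: "(L2_norm_cube m f)\<^sup>2 = (LINT x:cube m|(\<Pi>\<^sub>M i\<in>{..<m}. lborel). (f x)\<^sup>2)"
  unfolding L2_norm_cube_def set_lebesgue_integral_def
  by (intro real_sqrt_pow2 Bochner_Integration.integral_nonneg) simp

text \<open>Distinct multi-indices differ in some coordinate, and there the univariate integral is
  0. On the diagonal the integral is the weight by definition.\<close>

lemma set_integral_lagrange_mult:
  assumes "\<alpha> \<in> multi_indices m n" "\<beta> \<in> multi_indices m n"
  shows "(LINT x:cube m|(\<Pi>\<^sub>M i\<in>{..<m}. lborel). lagrange m n \<alpha> x * lagrange m n \<beta> x) =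
    (if \<alpha> = \<beta> then cubature_weight m n \<alpha> else 0)"
proof (cases "\<alpha> = \<beta>")
  case True
  then show ?thesis by (simp add: cubature_weight_def L2_norm_cube_sq) (simp add: power2_eq_square)
next
  case False
  moreover have "length \<alpha> = m" "length \<beta> = m" using assms by (simp_all add: multi_indices_def)
  ultimately obtain i where i: "i < m" "\<alpha> ! i \<noteq> \<beta> ! i"
    using nth_equalityI by metis
  then have "poly_integral (lagrange_poly n (\<alpha> ! i) * lagrange_poly n (\<beta> ! i)) = 0"
    using assms by (intro poly_integral_lagrange_mult) (simp_all add: multi_indices_def)
  then have "(\<Prod>i<m. poly_integral (lagrange_poly n (\<alpha> ! i) * lagrange_poly n (\<beta> ! i))) = 0"
    using i(1) by (intro prod_zero) auto
  then show ?thesis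
    using False unfolding lagrange_eq_tensor tensor_mult set_integral_tensor by simp
qed

lemma cubature_exact:
  assumes "interpolated m n f"
  shows "(L2_norm_cube m f)\<^sup>2 =
    (\<Sum>\<alpha>\<in>multi_indices m n. cubature_weight m n \<alpha> * (f (grid_point m n \<alpha>))\<^sup>2)"
proof -
  let ?A = "multi_indices m n" and ?c = "\<lambda>\<alpha>. f (grid_point m n \<alpha>)"
  let ?M = "\<Pi>\<^sub>M i\<in>{..<m}. lborel :: real measure"
  \<comment> \<open>Needed to exchange integral and finite sums below.\<close>
  have int: "integrable ?M (\<lambda>x. indicator (cube m) x * (lagrange m n \<alpha> x * lagrange m n \<beta> x))"
    for \<alpha> \<beta>
    using set_integrable_tensor[of m]
    unfolding set_integrable_def lagrange_eq_tensor tensor_mult real_scaleR_def .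
  have "(f x)\<^sup>2 = (\<Sum>\<alpha>\<in>?A. \<Sum>\<beta>\<in>?A. (?c \<alpha> * ?c \<beta>) * (lagrange m n \<alpha> x * lagrange m n \<beta> x))" for x
  proof -
    have "f x = (\<Sum>\<alpha>\<in>?A. ?c \<alpha> * lagrange m n \<alpha> x)"
      by (rule interpolatedD[OF assms])
    then show ?thesis
      unfolding power2_eq_square by (simp only: sum_product mult.assoc mult.left_commute)
  qed
  then have "(L2_norm_cube m f)\<^sup>2 = (LINT x:cube m|?M. \<Sum>\<alpha>\<in>?A. \<Sum>\<beta>\<in>?A.
      (?c \<alpha> * ?c \<beta>) * (lagrange m n \<alpha> x * lagrange m n \<beta> x))"
    by (simp only: L2_norm_cube_sq)
  also have "\<dots> = (\<integral>x. (\<Sum>\<alpha>\<in>?A. \<Sum>\<beta>\<in>?A.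
      (?c \<alpha> * ?c \<beta>) * (indicator (cube m) x * (lagrange m n \<alpha> x * lagrange m n \<beta> x))) \<partial>?M)"
    unfolding set_lebesgue_integral_def real_scaleR_def sum_distrib_left
    by (intro Bochner_Integration.integral_cong sum.cong refl mult.left_commute)
  also have "\<dots> = (\<Sum>\<alpha>\<in>?A. \<integral>x. (\<Sum>\<beta>\<in>?A.
      (?c \<alpha> * ?c \<beta>) * (indicator (cube m) x * (lagrange m n \<alpha> x * lagrange m n \<beta> x))) \<partial>?M)"
    by (intro Bochner_Integration.integral_sum Bochner_Integration.integrable_sum
        integrable_mult_right int)
  also have "\<dots> = (\<Sum>\<alpha>\<in>?A. \<Sum>\<beta>\<in>?A. \<integral>x.
      (?c \<alpha> * ?c \<beta>) * (indicator (cube m) x * (lagrange m n \<alpha> x * lagrange m n \<beta> x)) \<partial>?M)"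
    by (intro sum.cong refl Bochner_Integration.integral_sum integrable_mult_right int)
  also have "\<dots> = (\<Sum>\<alpha>\<in>?A. \<Sum>\<beta>\<in>?A. (?c \<alpha> * ?c \<beta>) *
      (LINT x:cube m|?M. lagrange m n \<alpha> x * lagrange m n \<beta> x))"
    unfolding set_lebesgue_integral_def real_scaleR_def by (simp only: integral_mult_right_zero)
  \<comment> \<open>Orthogonality removes the off-diagonal terms.\<close>
  also have "\<dots> = (\<Sum>\<alpha>\<in>?A. \<Sum>\<beta>\<in>?A. if \<alpha> = \<beta> then (?c \<alpha> * ?c \<beta>) * cubature_weight m n \<alpha> else 0)"
    by (rule sum.cong[OF refl], rule sum.cong[OF refl]) (simp add: set_integral_lagrange_mult)
  also have "\<dots> = (\<Sum>\<alpha>\<in>?A. cubature_weight m n \<alpha> * (?c \<alpha>)\<^sup>2)"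
    by (intro sum.cong refl) (simp add: finite_multi_indices power2_eq_square mult.commute)
  finally show ?thesis .
qed

section \<open>Differentiation matrices\<close>

lemma sum_multi_index_list:
  "(\<Sum>r<Suc n ^ m. g (multi_index_list m n ! r)) = (\<Sum>\<alpha>\<in>multi_indices m n. g \<alpha>)"
  by (rule sum.reindex_bij_betw, rule bij_betw_nth)
    (simp_all add: distinct_multi_index_list length_multi_index_list set_multi_index_list)

lemma grid_values_carrier: "grid_values m n f \<in> carrier_vec (Suc n ^ m)"
  by (simp add: grid_values_def)

lemma diff_mat_carrier: "diff_mat m n i \<in> carrier_mat (Suc n ^ m) (Suc n ^ m)"
  by (simp add: diff_mat_def)

text \<open>Entry \<open>r\<close> of the product is the differentiated Lagrange expansion of
  \<open>f\<close> at the grid point with position \<open>r\<close>.\<close>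

lemma diff_mat_mult_grid_values:
  assumes "interpolated m n f" "i < m"
  shows "diff_mat m n i *\<^sub>v grid_values m n f = grid_values m n (partial_deriv i f)"
proof (rule eq_vecI)
  fix r assume "r < dim_vec (grid_values m n (partial_deriv i f))"
  then have r: "r < Suc n ^ m" by (simp add: grid_values_def)
  let ?x = "grid_point m n (multi_index_list m n ! r)"
  have "(diff_mat m n i *\<^sub>v grid_values m n f) $ r =
      (\<Sum>c<Suc n ^ m. partial_deriv i (lagrange m n (multi_index_list m n ! c)) ?x *
        f (grid_point m n (multi_index_list m n ! c)))"
    using r by (simp add: diff_mat_def grid_values_def scalar_prod_def atLeast0LessThan)
  also have "\<dots> = partial_deriv i f ?x"
    by (subst sum_multi_index_list[of "\<lambda>\<alpha>. partial_deriv i (lagrange m n \<alpha>) ?x * f (grid_point m n \<alpha>)"])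
      (simp add: partial_deriv_interpolated[OF assms] mult.commute)
  finally show "(diff_mat m n i *\<^sub>v grid_values m n f) $ r = grid_values m n (partial_deriv i f) $ r"
    using r by (simp add: grid_values_def)
qed (simp add: diff_mat_def grid_values_def)

lemma diff_mat_pow_mult_grid_values:
  assumes "interpolated m n f" "i < m"
  shows "(diff_mat m n i ^\<^sub>m k) *\<^sub>v grid_values m n f = grid_values m n ((partial_deriv i ^^ k) f)"
  using assms(1)
proof (induction k arbitrary: f)
  case 0
  show ?case
    using one_mult_mat_vec[OF grid_values_carrier[of m n f]] by (simp add: diff_mat_def)
next
  case (Suc k)
  \<comment> \<open>Matrix powers split off their last factor on the right, so the first derivative
    hits \<open>f\<close> itself; hence the induction over arbitrary \<open>f\<close>.\<close>
  have "(diff_mat m n i ^\<^sub>m Suc k) *\<^sub>v grid_values m n f =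
      (diff_mat m n i ^\<^sub>m k) *\<^sub>v (diff_mat m n i *\<^sub>v grid_values m n f)"
    by (simp add: assoc_mult_mat_vec[OF pow_carrier_mat[OF diff_mat_carrier] diff_mat_carrier
          grid_values_carrier])
  also have "\<dots> = grid_values m n ((partial_deriv i ^^ k) (partial_deriv i f))"
    using Suc assms(2) by (simp add: diff_mat_mult_grid_values interpolated_partial_deriv)
  finally show ?case by (simp add: funpow_swap1)
qed

text \<open>Carrier and action are proved together, since associativity in the action uses the
  carrier of the remaining product.\<close>

lemma diff_mat_foldr:
  assumes "interpolated m n f" "set is \<subseteq> {..<m}"
  shows "foldr (\<lambda>i M. (diff_mat m n i ^\<^sub>m (\<beta> ! i)) * M) is (1\<^sub>m (Suc n ^ m))
      \<in> carrier_mat (Suc n ^ m) (Suc n ^ m) \<and>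
    foldr (\<lambda>i M. (diff_mat m n i ^\<^sub>m (\<beta> ! i)) * M) is (1\<^sub>m (Suc n ^ m)) *\<^sub>v grid_values m n f =
      grid_values m n (foldr (\<lambda>i. partial_deriv i ^^ (\<beta> ! i)) is f)"
  using assms(2)
proof (induction "is")
  case Nil
  show ?case
    using one_mult_mat_vec[OF grid_values_carrier[of m n f]] by simp
next
  case (Cons i js)
  have P: "diff_mat m n i ^\<^sub>m (\<beta> ! i) \<in> carrier_mat (Suc n ^ m) (Suc n ^ m)"
    by (intro pow_carrier_mat diff_mat_carrier)
  from Cons show ?case
    by (auto simp: assoc_mult_mat_vec[OF P _ grid_values_carrier] diff_mat_pow_mult_grid_values
        interpolated_partial_deriv_foldr[OF assms(1)] intro!: mult_carrier_mat[OF P])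
qed

lemma diff_mat_multi_carrier: "diff_mat_multi m n \<beta> \<in> carrier_mat (Suc n ^ m) (Suc n ^ m)"
  unfolding diff_mat_multi_def
  \<comment> \<open>The tensor of zero polynomials serves as the interpolated function for
    \<open>diff_mat_foldr\<close>.\<close>
  using diff_mat_foldr[of m n "tensor m (\<lambda>_. 0)"] interpolated_tensor[of m "\<lambda>_. 0" n] by (auto simp: atLeast0LessThan)

lemma diff_mat_multi_mult_grid_values:
  "interpolated m n f \<Longrightarrow>
    diff_mat_multi m n \<beta> *\<^sub>v grid_values m n f = grid_values m n (partial_deriv_multi m \<beta> f)"
  unfolding diff_mat_multi_def partial_deriv_multi_def using diff_mat_foldr[of m n f "[0..<m]"] by (auto simp: atLeast0LessThan)

section \<open>Quadratic forms\<close>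

lemma weight_mat_carrier: "weight_mat m n \<in> carrier_mat (Suc n ^ m) (Suc n ^ m)"
  by (simp add: weight_mat_def)

lemma weight_mat_quadratic_form:
  "scalar_prod (grid_values m n g) (weight_mat m n *\<^sub>v grid_values m n g) =
    (\<Sum>\<alpha>\<in>multi_indices m n. cubature_weight m n \<alpha> * (g (grid_point m n \<alpha>))\<^sup>2)"
proof -
  have "(weight_mat m n *\<^sub>v grid_values m n g) $ r =
      cubature_weight m n (multi_index_list m n ! r) * grid_values m n g $ r" if "r < Suc n ^ m" for r
    using that
    by (simp add: weight_mat_def mat_diag_def grid_values_def scalar_prod_def if_distrib
        if_distribR cong: if_cong)
  then have "scalar_prod (grid_values m n g) (weight_mat m n *\<^sub>v grid_values m n g) =
      (\<Sum>r<Suc n ^ m. cubature_weight m n (multi_index_list m n ! r) *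
        (g (grid_point m n (multi_index_list m n ! r)))\<^sup>2)"
    using weight_mat_carrier[of m n]
    by (auto simp: scalar_prod_def atLeast0LessThan grid_values_def power2_eq_square intro!: sum.cong)
  then show ?thesis
    by (simp add: sum_multi_index_list[of "\<lambda>\<alpha>. cubature_weight m n \<alpha> * (g (grid_point m n \<alpha>))\<^sup>2"])
qed

text \<open>A quadratic form is linear in its matrix; with an entrywise sum this amounts to
  exchanging finite sums.\<close>

lemma scalar_prod_sum_mat:
  fixes v :: "real Matrix.vec"
  assumes "v \<in> carrier_vec N" "\<And>b. M b \<in> carrier_mat N N"
  shows "scalar_prod v (Matrix.mat N N (\<lambda>(r, c). \<Sum>b\<in>B. M b $$ (r, c)) *\<^sub>v v) =
    (\<Sum>b\<in>B. scalar_prod v (M b *\<^sub>v v))"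
proof -
  have dims: "dim_vec v = N" "dim_row (M b) = N" "dim_col (M b) = N" for b
    using assms by auto
  have "scalar_prod v (Matrix.mat N N (\<lambda>(r, c). \<Sum>b\<in>B. M b $$ (r, c)) *\<^sub>v v) =
      (\<Sum>r<N. \<Sum>c<N. \<Sum>b\<in>B. v $ r * (M b $$ (r, c) * v $ c))"
    by (simp add: scalar_prod_def dims atLeast0LessThan sum_distrib_left sum_distrib_right)
  also have "\<dots> = (\<Sum>r<N. \<Sum>b\<in>B. \<Sum>c<N. v $ r * (M b $$ (r, c) * v $ c))"
    by (intro sum.cong refl sum.swap)
  also have "\<dots> = (\<Sum>b\<in>B. \<Sum>r<N. \<Sum>c<N. v $ r * (M b $$ (r, c) * v $ c))"
    by (rule sum.swap)
  also have "\<dots> = (\<Sum>b\<in>B. scalar_prod v (M b *\<^sub>v v))"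
    by (simp add: scalar_prod_def dims atLeast0LessThan sum_distrib_left)
  finally show ?thesis .
qed

theorem theorem1:
  fixes m n k :: nat and f :: "(nat \<Rightarrow> real) \<Rightarrow> real"
  assumes "f \<in> poly_space m n"
  shows "(sobolev_norm m k f)\<^sup>2 =
    scalar_prod (grid_values m n f) (sobolev_cubature_mat m n k *\<^sub>v grid_values m n f)"
proof -
  let ?F = "grid_values m n f" and ?D = "diff_mat_multi m n" and ?W = "weight_mat m n"
  let ?B = "multi_indices_sum_le m k"
  note carriers = diff_mat_multi_carrier weight_mat_carrier grid_values_carrier
  have f: "interpolated m n f" using assms by (rule interpolated_poly_space)
  \<comment> \<open>Moving the transpose across the scalar product turns each summand into the
    weighted sum of squares of \<open>?D \<beta> *\<^sub>v ?F\<close>, the grid values of a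
    derivative of \<open>f\<close>.\<close>
  have "scalar_prod ?F ((transpose_mat (?D \<beta>) * ?W * ?D \<beta>) *\<^sub>v ?F) =
      (L2_norm_cube m (partial_deriv_multi m \<beta> f))\<^sup>2" for \<beta>
  proof -
    have Dt: "transpose_mat (?D \<beta>) \<in> carrier_mat (Suc n ^ m) (Suc n ^ m)"
      using diff_mat_multi_carrier by simp
    have WD: "?W *\<^sub>v (?D \<beta> *\<^sub>v ?F) \<in> carrier_vec (Suc n ^ m)"
      using carriers by (intro mult_mat_vec_carrier)
    have "(transpose_mat (?D \<beta>) * ?W * ?D \<beta>) *\<^sub>v ?F =
        transpose_mat (?D \<beta>) *\<^sub>v (?W *\<^sub>v (?D \<beta> *\<^sub>v ?F))"
      by (simp add: assoc_mult_mat_vec[OF mult_carrier_mat[OF Dt weight_mat_carrier]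
            diff_mat_multi_carrier grid_values_carrier]
          assoc_mult_mat_vec[OF Dt weight_mat_carrier
            mult_mat_vec_carrier[OF diff_mat_multi_carrier grid_values_carrier]])
    then have "scalar_prod ?F ((transpose_mat (?D \<beta>) * ?W * ?D \<beta>) *\<^sub>v ?F) =
        scalar_prod (transpose_mat (?D \<beta>) *\<^sub>v (?W *\<^sub>v (?D \<beta> *\<^sub>v ?F))) ?F"
      by (simp add: comm_scalar_prod[OF grid_values_carrier mult_mat_vec_carrier[OF Dt WD]])
    also have "\<dots> = scalar_prod (?W *\<^sub>v (?D \<beta> *\<^sub>v ?F)) (?D \<beta> *\<^sub>v ?F)"
      by (rule transpose_vec_mult_scalar[OF diff_mat_multi_carrier grid_values_carrier WD])
    also have "\<dots> = scalar_prod (?D \<beta> *\<^sub>v ?F) (?W *\<^sub>v (?D \<beta> *\<^sub>v ?F))"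
      by (rule comm_scalar_prod[OF WD mult_mat_vec_carrier[OF diff_mat_multi_carrier grid_values_carrier]])
    also have "\<dots> = (L2_norm_cube m (partial_deriv_multi m \<beta> f))\<^sup>2"
      \<comment> \<open>The derivative is again interpolated on the same grid, so
        \<open>cubature_exact\<close> applies to it.\<close>
      using interpolated_partial_deriv_foldr[OF f, of "[0..<m]" \<beta>]
      by (simp add: diff_mat_multi_mult_grid_values[OF f] weight_mat_quadratic_form
          cubature_exact partial_deriv_multi_def atLeast0LessThan)
    finally show ?thesis .
  qed
  moreover have "transpose_mat (?D \<beta>) * ?W * ?D \<beta> \<in> carrier_mat (Suc n ^ m) (Suc n ^ m)" for \<beta>
    using carriers by (intro mult_carrier_mat) auto
  ultimately have "scalar_prod ?F (sobolev_cubature_mat m n k *\<^sub>v ?F) =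
      (\<Sum>\<beta>\<in>?B. (L2_norm_cube m (partial_deriv_multi m \<beta> f))\<^sup>2)"
    unfolding sobolev_cubature_mat_def
    by (subst scalar_prod_sum_mat[OF grid_values_carrier]) auto
  then show ?thesis by (simp add: sobolev_norm_def sum_nonneg)
qed

end
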